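(* Let $a\ge2$ be an integer and let $P_m(x)=b_0x^m+b_1x^{m-1}+\cdots+b_{m-1}x+b_m$ be a polynomial all of whose coefficients $b_0,\dots,b_m$ are positive integers. Put $c_n=\frac{1}{a^{P_m(n)}}$ for $n\ge1$. Then the series $\sum_{n=1}^{\infty}c_n$ converges to an irrational number if and only if $\lim_{n\to\infty}\frac{c_{n+1}}{c_n}=0$. *)

theory Defs
  imports Complex_Main "HOL-Computational_Algebra.Polynomial"
begin

end

theory Submission
  imports Defs
begin

text \<open>
  If the ratios tend to zero and the sum were \<open>u / v\<close>, then multiplying the tail after index \<open>N\<close>
  by \<open>v\<close> and by the last denominator \<open>q N\<close>, which is a multiple of all previous ones,
  would give a positive integer; comparison with a geometric series makes it smaller than 1 for
  large \<open>N\<close>. Conversely, for degree 0 the series diverges, for degree 1 it is geometric with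
  rational sum, and for degree at least 2 the increments of the polynomial tend to infinity.
\<close>

lemma summable_inverse_if_ratio_tendsto_0:
  fixes q :: "nat \<Rightarrow> int"
  assumes pos: "\<And>n. q n > 0"
    and lim: "(\<lambda>n. real_of_int (q n) / real_of_int (q (Suc n))) \<longlonglongrightarrow> 0"
  shows "summable (\<lambda>n. 1 / real_of_int (q n))"
proof -
  have "eventually (\<lambda>n. real_of_int (q n) / real_of_int (q (Suc n)) < 1/2) sequentially"
    by (rule order_tendstoD(2)[OF lim]) simp
  then obtain N where N: "\<And>n. n \<ge> N \<Longrightarrow> real_of_int (q n) / real_of_int (q (Suc n)) < 1/2"
    by (auto simp: eventually_sequentially)
  show ?thesis
  proof (rule summable_ratio_test[of "1/2" N])
    fix n assume "n \<ge> N"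
    from N[OF this] show "norm (1 / real_of_int (q (Suc n))) \<le> 1/2 * norm (1 / real_of_int (q n))"
      using pos[of n] pos[of "Suc n"] by (simp add: field_simps)
  qed simp
qed

text \<open>Stated for an arbitrary divisibility chain of positive integers: the powers of
  \<open>a\<close> in the theorem enter only through \<open>q n dvd q (Suc n)\<close> and the
  vanishing ratio.\<close>

lemma suminf_inverse_irrational:
  fixes q :: "nat \<Rightarrow> int"
  assumes pos: "\<And>n. q n > 0"
    and dvd: "\<And>n. q n dvd q (Suc n)"
    and lim: "(\<lambda>n. real_of_int (q n) / real_of_int (q (Suc n))) \<longlonglongrightarrow> 0"
  shows "(\<Sum>n. 1 / real_of_int (q n)) \<notin> \<rat>"
proof
  define x where "x n = 1 / real_of_int (q n)" for n
  have xpos: "x n > 0" for n using pos[of n] by (simp add: x_def)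
  have sm: "summable x"
    using summable_inverse_if_ratio_tendsto_0[OF pos lim] by (simp add: x_def[abs_def])
  assume "(\<Sum>n. 1 / real_of_int (q n)) \<in> \<rat>"
  hence "suminf x \<in> \<rat>" by (simp add: x_def[abs_def])
  then obtain u v :: int where v: "v > 0" and uv: "suminf x = real_of_int u / real_of_int v"
    by (elim Rats_cases') auto
  \<comment> \<open>This choice gives \<open>e / (1 - e) = 1 / (v + 1)\<close>. A tail decaying with
    ratio \<open>e\<close> after \<open>x N\<close> is then at most \<open>x N / (v + 1)\<close>,
    and multiplying by \<open>v * q N\<close> leaves \<open>v / (v + 1) < 1\<close>.\<close>
  define e where "e = 1 / (real_of_int v + 2)"
  have e: "0 < e" "e < 1" using v by (simp_all add: e_def)
  have "eventually (\<lambda>n. real_of_int (q n) / real_of_int (q (Suc n)) < e) sequentially"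
    by (rule order_tendstoD(2)[OF lim e(1)])
  then obtain N where N: "\<And>n. n \<ge> N \<Longrightarrow> real_of_int (q n) / real_of_int (q (Suc n)) < e"
    by (auto simp: eventually_sequentially)
  have step: "x (Suc n) \<le> e * x n" if "n \<ge> N" for n
    using N[OF that] pos[of n] pos[of "Suc n"] by (simp add: x_def field_simps)
  \<comment> \<open>The extra factor \<open>e\<close> is there because the tail starts at
    \<open>Suc N\<close>, one step after \<open>x N\<close>.\<close>
  have geo: "x (k + Suc N) \<le> (x N * e) * e ^ k" for k
  proof (induction k)
    case 0
    show ?case using step[of N] by (simp add: mult.commute)
  next
    case (Suc k)
    have "x (Suc k + Suc N) \<le> e * x (k + Suc N)" using step[of "k + Suc N"] by simp
    also have "\<dots> \<le> e * ((x N * e) * e ^ k)" using Suc e by (intro mult_left_mono) auto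
    finally show ?case by (simp add: mult_ac)
  qed
  define T where "T = (\<Sum>k. x (k + Suc N))"
  have smT: "summable (\<lambda>k. x (k + Suc N))" using sm by (subst summable_iff_shift)
  have Tpos: "T > 0" unfolding T_def by (rule suminf_pos[OF smT]) (rule xpos)
  have gs: "(\<lambda>k. (x N * e) * e ^ k) sums ((x N * e) * (1 / (1 - e)))"
    using e by (intro sums_mult geometric_sums) simp
  have "T \<le> (x N * e) * (1 / (1 - e))"
    unfolding T_def using suminf_le[OF geo smT sums_summable[OF gs]] sums_unique[OF gs] by simp
  also have "1 - e = (real_of_int v + 1) * e" using v by (simp add: e_def field_simps)
  also have "x N * e * (1 / ((real_of_int v + 1) * e)) = x N / (real_of_int v + 1)"
    using e(1) by simp
  finally have Tle: "T \<le> x N / (real_of_int v + 1)" .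
  have dvdN: "q n dvd q N" if "n \<le> N" for n
    using that by (induction rule: dec_induct) (auto intro: dvd_trans dvd)
  have "real_of_int (q N) * (\<Sum>n<Suc N. x n) = (\<Sum>n<Suc N. real_of_int (q N div q n))"
    unfolding sum_distrib_left using dvdN
    by (intro sum.cong) (auto simp: x_def real_of_int_div)
  also have "\<dots> \<in> \<int>" by (intro Ints_sum) auto
  finally have int1: "real_of_int (q N) * (\<Sum>n<Suc N. x n) \<in> \<int>" .
  have "suminf x = T + (\<Sum>n<Suc N. x n)"
    unfolding T_def by (rule suminf_split_initial_segment[OF sm])
  \<comment> \<open>The factor \<open>v\<close> clears the assumed rational sum and
    \<open>q N\<close> clears the partial sum, so the scaled tail is a difference of
    integers.\<close>
  hence "real_of_int v * real_of_int (q N) * T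
      = real_of_int (q N) * real_of_int u
        - real_of_int v * (real_of_int (q N) * (\<Sum>n<Suc N. x n))"
    using uv v by (simp add: field_simps)
  also have "\<dots> \<in> \<int>" by (intro Ints_diff Ints_mult[OF _ int1] Ints_mult[OF Ints_of_int Ints_of_int] Ints_of_int)
  finally obtain z :: int where z: "real_of_int v * real_of_int (q N) * T = real_of_int z"
    by (auto elim: Ints_cases)
  have "0 < real_of_int v * real_of_int (q N) * T" using v pos[of N] Tpos by simp
  moreover have "real_of_int v * real_of_int (q N) * T
      \<le> real_of_int v * real_of_int (q N) * (x N / (real_of_int v + 1))"
    using v pos[of N] Tle by (intro mult_left_mono) auto
  moreover have "real_of_int v * real_of_int (q N) * (x N / (real_of_int v + 1)) < 1"
    using v pos[of N] by (simp add: x_def)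
  ultimately have "0 < real_of_int z" "real_of_int z < 1" using z by linarith+
  thus False by simp
qed

lemma poly_nat_mono:
  fixes p :: "nat poly"
  assumes "x \<le> y"
  shows "poly p x \<le> poly p y"
  using assms by (induction p) (auto intro: add_mono mult_mono)

text \<open>Write \<open>Suc n ^ m\<close> as \<open>n + 1\<close> copies of
  \<open>Suc n ^ (m - 1)\<close>: \<open>n\<close> copies dominate \<open>n ^ m\<close>, and the
  remaining one is at least \<open>Suc n\<close> because \<open>m - 1\<close> is positive.\<close>

lemma power_Suc_base_ge:
  fixes n m :: nat
  assumes "m \<ge> 2"
  shows "n ^ m + n \<le> Suc n ^ m"
proof -
  obtain k where k: "m = Suc (Suc k)" using assms by (metis Suc_le_D numeral_2_eq_2 Suc_le_mono)
  have "n * n ^ Suc k \<le> n * Suc n ^ Suc k" by (intro mult_left_mono power_mono) auto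
  moreover have "Suc n ^ 1 \<le> Suc n ^ Suc k" by (intro power_increasing) auto
  ultimately have "n * n ^ Suc k + n \<le> n * Suc n ^ Suc k + Suc n ^ Suc k"
    unfolding power_one_right by linarith
  thus ?thesis by (simp only: k power_Suc[of _ "Suc k"] mult_Suc add.commute)
qed

theorem theorem5:
  fixes a :: int and m :: nat and b :: "nat \<Rightarrow> nat"
    and P :: "nat poly" and c :: "nat \<Rightarrow> real"
  assumes a: "a \<ge> 2"
    and b: "\<And>i. i \<le> m \<Longrightarrow> b i > 0"
    and P: "P = (\<Sum>i\<le>m. monom (b i) (m - i))"
    and c: "\<And>n. n \<ge> 1 \<Longrightarrow> c n = 1 / real_of_int a ^ poly P n"
  shows "(\<exists>s. (\<lambda>n. c (Suc n)) sums s \<and> s \<notin> \<rat>) \<longleftrightarrow>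
    (\<lambda>n. c (Suc n) / c n) \<longlonglongrightarrow> 0"
proof
  assume lim: "(\<lambda>n. c (Suc n) / c n) \<longlonglongrightarrow> 0"
  \<comment> \<open>The index is shifted because \<open>c 0\<close> is unspecified; the terms of the
    series start at \<open>c 1\<close>.\<close>
  define q where "q n = a ^ poly P (Suc n)" for n
  have cq: "c (Suc n) = 1 / real_of_int (q n)" for n by (simp add: c q_def)
  have pos: "q n > 0" for n using a by (simp add: q_def)
  \<comment> \<open>With natural coefficients the exponents \<open>poly P n\<close> are
    nondecreasing, so each power of \<open>a\<close> divides the next.\<close>
  have dvd: "q n dvd q (Suc n)" for n
    unfolding q_def by (intro le_imp_power_dvd poly_nat_mono) simp
  have ratio: "(\<lambda>n. real_of_int (q n) / real_of_int (q (Suc n))) \<longlonglongrightarrow> 0"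
    using LIMSEQ_Suc[OF lim] by (simp add: cq)
  have "(\<lambda>n. c (Suc n)) sums (\<Sum>n. 1 / real_of_int (q n))"
    using summable_sums[OF summable_inverse_if_ratio_tendsto_0[OF pos ratio]] by (simp add: cq)
  thus "\<exists>s. (\<lambda>n. c (Suc n)) sums s \<and> s \<notin> \<rat>"
    using suminf_inverse_irrational[OF pos dvd ratio] by blast
next
  assume "\<exists>s. (\<lambda>n. c (Suc n)) sums s \<and> s \<notin> \<rat>"
  then obtain s where s: "(\<lambda>n. c (Suc n)) sums s" "s \<notin> \<rat>" by blast
  have poly_P: "poly P n = (\<Sum>i\<le>m. b i * n ^ (m - i))" for n
    by (simp add: P poly_sum poly_monom)
  have "m \<noteq> 0"
  proof
    assume "m = 0"
    hence "c (Suc n) = 1 / real_of_int a ^ b 0" for n by (simp add: c poly_P)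
    moreover have "(\<lambda>n. c (Suc n)) \<longlonglongrightarrow> 0"
      using summable_LIMSEQ_zero[OF sums_summable[OF s(1)]] .
    ultimately show False using a by (simp add: LIMSEQ_const_iff)
  qed
  moreover have "m \<noteq> 1"
  proof
    assume "m = 1"
    define r where "r = 1 / real_of_int a ^ b 0"
    \<comment> \<open>Here \<open>poly P (Suc n) = b 0 * n + (b 0 + b 1)\<close>, so the ratio
      \<open>r\<close> is rational, and it is below 1 since \<open>b 0\<close> is positive.\<close>
    have "c (Suc n) = 1 / real_of_int a ^ (b 0 + b 1) * r ^ n" for n
      using \<open>m = 1\<close> by (simp add: c poly_P r_def power_add power_mult power_one_over)
    moreover have "real_of_int a ^ b 0 > 1"
      using a b[of 0] by (intro one_less_power) auto
    hence "(\<lambda>n. 1 / real_of_int a ^ (b 0 + b 1) * r ^ n) sums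
        (1 / real_of_int a ^ (b 0 + b 1) * (1 / (1 - r)))"
      by (intro sums_mult geometric_sums) (simp add: r_def)
    ultimately have "s = 1 / real_of_int a ^ (b 0 + b 1) * (1 / (1 - r))"
      using s(1) by (simp add: sums_unique2)
    also have "\<dots> \<in> \<rat>" by (simp add: r_def)
    finally show False using s(2) by simp
  qed
  ultimately have m: "m \<ge> 2" by simp
  \<comment> \<open>The leading monomial alone supplies the gain \<open>n\<close>, using
    \<open>b 0 \<ge> 1\<close>; all other monomials merely do not decrease.\<close>
  have gap: "poly P n + n \<le> poly P (Suc n)" for n
  proof -
    have split: "poly P k = b 0 * k ^ m + (\<Sum>i\<in>{..m} - {0}. b i * k ^ (m - i))" for k
      unfolding poly_P by (subst sum.remove[of _ 0]) auto
    have "n \<le> b 0 * n" using b[of 0] by simp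
    hence "b 0 * n ^ m + n \<le> b 0 * (n ^ m + n)" by (simp add: distrib_left)
    also have "\<dots> \<le> b 0 * Suc n ^ m" using power_Suc_base_ge[OF m, of n] by (rule mult_le_mono2)
    finally have "b 0 * n ^ m + n \<le> b 0 * Suc n ^ m" .
    moreover have "(\<Sum>i\<in>{..m} - {0}. b i * n ^ (m - i)) \<le> (\<Sum>i\<in>{..m} - {0}. b i * Suc n ^ (m - i))"
      by (intro sum_mono mult_left_mono power_mono) auto
    ultimately show ?thesis unfolding split by linarith
  qed
  \<comment> \<open>An exponent increment of at least \<open>n\<close> divides the term by at least
    \<open>a ^ n\<close>. The case \<open>n = 0\<close> is left out since \<open>c 0\<close> is
    arbitrary.\<close>
  have bound: "c (Suc n) / c n \<le> (1 / real_of_int a) ^ n" if "n \<ge> 1" for n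
  proof -
    have "real_of_int a ^ poly P n * real_of_int a ^ n \<le> real_of_int a ^ poly P (Suc n)"
      unfolding power_add[symmetric] using a gap[of n] by (intro power_increasing) auto
    thus ?thesis using that a by (simp add: c field_simps)
  qed
  have "(\<lambda>n. (1 / real_of_int a) ^ n) \<longlonglongrightarrow> 0"
    using a by (intro LIMSEQ_power_zero) simp
  thus "(\<lambda>n. c (Suc n) / c n) \<longlonglongrightarrow> 0"
  proof (rule tendsto_sandwich[OF _ _ tendsto_const, rotated 2])
    show "eventually (\<lambda>n. 0 \<le> c (Suc n) / c n) sequentially"
      using eventually_ge_at_top[of 1] by eventually_elim (use a in \<open>simp add: c\<close>)
    show "eventually (\<lambda>n. c (Suc n) / c n \<le> (1 / real_of_int a) ^ n) sequentially"
      using eventually_ge_at_top[of 1] by eventually_elim (rule bound)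
  qed
qed

end
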